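(* Let $Q$ be a finite, connected, graded poset. Let $I_1, I_2, \dots, I_{N(Q)}$ be an enumeration of all the ideals of $Q$. Let $A_Q$ be the $N(Q)\times N(Q)$ matrix whose $(i,j)$-entry $a_{ij}$ equals $x^{\#(\max(I_i)\setminus I_j)}$ if $I_j\subseteq I_i$, and equals $0$ otherwise. For each integer $k\ge 1$, let $V_Q^{(k)}$ be the column vector whose $i$-th entry is $\mathcal{N}_{I_i}^k(x)$ for $1\le i\le N(Q)$. Then for every $k\ge 1$, $$V_Q^{(k)}=A_Q^{k-1}V_Q^{(1)}.$$
   Context: A finite poset is graded if all its maximal chains have the same length. An ideal of $Q$ is a subset $I\subseteq Q$ such that $x\le y$ in $Q$ and $y\in I$ imply $x\in I$ (the empty set is an ideal). $N(Q)$ denotes the number of ideals of $Q$. For an ideal $I$, $\max(I)$ denotes the set of maximal elements of $I$. For an ideal $I$ of $Q$ and an integer $k\ge 1$, define $$\mathcal{N}_I^k(x):=\sum_{I_1\subseteq\cdots\subseteq I_{k-1}\subseteq I_k=I} x^{\sum_{j=1}^k \#(\max(I_j)\setminus I_{j-1})},$$ where the sum runs over all increasing $(k-1)$-sequences $I_1\subseteq\cdots\subseteq I_{k-1}$ of ideals of $Q$ contained in $I$, with the conventions $I_k:=I$ and $I_0:=\emptyset$. (In this definition the $I_j$ denote arbitrary ideals, unrelated to the enumeration in the claim.) *)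

theory Defs
  imports
    "Jordan_Normal_Form.Matrix"
    "HOL-Computational_Algebra.Polynomial"
begin

text \<open>
  A finite poset is a finite carrier \<open>Q\<close> together with a relation \<open>r\<close> such that
  \<open>partial_order_on Q r\<close>; here \<open>(x, y) \<in> r\<close> means $x \le y$.
\<close>

definition hasse :: "('a \<times> 'a) set \<Rightarrow> ('a \<times> 'a) set" where
  "hasse r = {(x, y) \<in> r. x \<noteq> y \<and> (\<forall>z. (x, z) \<in> r \<and> (z, y) \<in> r \<longrightarrow> z = x \<or> z = y)}"

text \<open>Connectedness of the Hasse diagram, regarded as an undirected graph.\<close>
definition connected_poset :: "'a set \<Rightarrow> ('a \<times> 'a) set \<Rightarrow> bool" where
  "connected_poset Q r \<longleftrightarrow> (\<forall>x\<in>Q. \<forall>y\<in>Q. (x, y) \<in> (hasse r \<union> (hasse r)\<inverse>)\<^sup>*)"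

text \<open>
  The length of a chain is one less than its number of elements, so
  equal lengths amount to equal cardinalities.
\<close>
definition graded_poset :: "'a set \<Rightarrow> ('a \<times> 'a) set \<Rightarrow> bool" where
  "graded_poset Q r \<longleftrightarrow>
    (\<forall>C D. pred_on.maxchain Q (\<lambda>x y. (x, y) \<in> r) C \<and> pred_on.maxchain Q (\<lambda>x y. (x, y) \<in> r) D
       \<longrightarrow> card C = card D)"

definition order_ideals :: "'a set \<Rightarrow> ('a \<times> 'a) set \<Rightarrow> 'a set set" where
  "order_ideals Q r = {I. I \<subseteq> Q \<and> (\<forall>x\<in>Q. \<forall>y\<in>I. (x, y) \<in> r \<longrightarrow> x \<in> I)}"

definition num_ideals :: "'a set \<Rightarrow> ('a \<times> 'a) set \<Rightarrow> nat" where
  "num_ideals Q r = card (order_ideals Q r)"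

definition max_elems :: "('a \<times> 'a) set \<Rightarrow> 'a set \<Rightarrow> 'a set" where
  "max_elems r I = {x \<in> I. \<forall>y\<in>I. (x, y) \<in> r \<longrightarrow> y = x}"

text \<open>The indeterminate $x$.\<close>
abbreviation X :: "int poly" where
  "X \<equiv> monom 1 1"

text \<open>
  The exponent for a sequence \<open>Is\<close> listing $I_0, I_1, \dots, I_k$ (so \<open>Is ! j\<close> is $I_j$).
\<close>
definition seq_exponent :: "('a \<times> 'a) set \<Rightarrow> nat \<Rightarrow> 'a set list \<Rightarrow> nat" where
  "seq_exponent r k Is = (\<Sum>j = 1..k. card (max_elems r (Is ! j) - Is ! (j - 1)))"

text \<open>
  The list \<open>Js\<close> is $I_1, \dots, I_{k-1}$. The definition is meaningful for $k \ge 1$ only; for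
  finite \<open>Q\<close> the index set of the sum is finite.
\<close>
definition ideal_poly :: "'a set \<Rightarrow> ('a \<times> 'a) set \<Rightarrow> nat \<Rightarrow> 'a set \<Rightarrow> int poly" where
  "ideal_poly Q r k I =
    (\<Sum>Js | length Js = k - 1 \<and> set Js \<subseteq> order_ideals Q r \<and> sorted_wrt (\<subseteq>) (Js @ [I]).
       X ^ seq_exponent r k ({} # Js @ [I]))"

text \<open>
  In the following, \<open>e\<close> enumerates the ideals, indexed from \<open>0\<close> as is usual for
  \<open>mat\<close> and \<open>vec\<close>.
\<close>
definition A_mat :: "'a set \<Rightarrow> ('a \<times> 'a) set \<Rightarrow> (nat \<Rightarrow> 'a set) \<Rightarrow> int poly mat" where
  "A_mat Q r e = mat (num_ideals Q r) (num_ideals Q r)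
    (\<lambda>(i, j). if e j \<subseteq> e i then X ^ card (max_elems r (e i) - e j) else 0)"

definition V_vec :: "'a set \<Rightarrow> ('a \<times> 'a) set \<Rightarrow> (nat \<Rightarrow> 'a set) \<Rightarrow> nat \<Rightarrow> int poly vec" where
  "V_vec Q r e k = vec (num_ideals Q r) (\<lambda>i. ideal_poly Q r k (e i))"

end

theory Submission
  imports Defs
begin

text \<open>
  Splitting a sequence $I_1 \subseteq \dots \subseteq I_k \subseteq I$ at its last free member
  $J = I_k$ turns the defining sum into
  $\mathcal{N}_I^{k+1} = \sum_{J \subseteq I} x^{\#(\max(I) \setminus J)} \mathcal{N}_J^k$,
  which is one multiplication by $A_Q$.
\<close>

lemma finite_order_ideals: "finite Q \<Longrightarrow> finite (order_ideals Q r)"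
  by (rule finite_subset[of _ "Pow Q"]) (auto simp: order_ideals_def)

text \<open>Since \<open>Is\<close> holds positions 0 to \<open>k\<close>, with position 0 playing
  the role of the conventional empty $I_0$, the summands with j \<le> k look only inside
  \<open>Is\<close>. Appending \<open>I\<close> adds the single summand at position
  \<open>Suc k\<close>, whose predecessor is \<open>Is ! k\<close>.\<close>

lemma seq_exponent_snoc:
  assumes "length Is = Suc k"
  shows "seq_exponent r (Suc k) (Is @ [I]) =
    seq_exponent r k Is + card (max_elems r I - Is ! k)"
proof -
  have "(\<Sum>j = 1..k. card (max_elems r ((Is @ [I]) ! j) - (Is @ [I]) ! (j - 1))) =
      (\<Sum>j = 1..k. card (max_elems r (Is ! j) - Is ! (j - 1)))"
    using assms by (intro sum.cong refl) (auto simp: nth_append)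
  then show ?thesis
    using assms by (simp add: seq_exponent_def nth_append)
qed

text \<open>\<open>sorted_wrt\<close> compares all pairs, but transitivity through \<open>J\<close>
  supplies every comparison with \<open>I\<close> except the last. This makes the constraint on
  \<open>Js\<close> independent of \<open>I\<close> once \<open>J\<close> is fixed.\<close>

lemma sorted_wrt_subset_snoc2:
  "sorted_wrt (\<subseteq>) (Js @ [J, I]) \<longleftrightarrow> sorted_wrt (\<subseteq>) (Js @ [J]) \<and> J \<subseteq> I"
  by (auto simp: sorted_wrt_append)

lemma ideal_poly_Suc:
  assumes "finite Q" and "k \<ge> 1"
  shows "ideal_poly Q r (Suc k) I =
    (\<Sum>J | J \<in> order_ideals Q r \<and> J \<subseteq> I. X ^ card (max_elems r I - J) * ideal_poly Q r k J)"
proof -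
  \<comment> \<open>The index set of \<open>ideal_poly\<close>, as a function of its top ideal: the
    inner sum ranges over \<open>S k J\<close>, which varies with \<open>J\<close>, so the double
    sum lives on a \<open>Sigma\<close>.\<close>
  define S where "S k I = {Js. length Js = k - 1 \<and> set Js \<subseteq> order_ideals Q r \<and>
    sorted_wrt (\<subseteq>) (Js @ [I])}" for k I
  let ?T = "{J. J \<in> order_ideals Q r \<and> J \<subseteq> I}"
  have fin_S: "finite (S k J)" for J
    by (rule finite_subset[OF _ finite_lists_length_eq[OF finite_order_ideals[OF assms(1)], of r "k - 1"]])
      (auto simp: S_def)
  have fin_T: "finite ?T"
    using finite_order_ideals[OF assms(1)] by simp
  have "(\<Sum>J\<in>?T. X ^ card (max_elems r I - J) * ideal_poly Q r k J) =
      (\<Sum>J\<in>?T. \<Sum>Js\<in>S k J. X ^ card (max_elems r I - J) * X ^ seq_exponent r k ({} # Js @ [J]))"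
    by (simp add: ideal_poly_def S_def sum_distrib_left)
  also have "\<dots> = (\<Sum>(J, Js)\<in>Sigma ?T (S k).
      X ^ card (max_elems r I - J) * X ^ seq_exponent r k ({} # Js @ [J]))"
    using fin_S fin_T by (intro sum.Sigma) auto
  also have "\<dots> = (\<Sum>Js\<in>S (Suc k) I. X ^ seq_exponent r (Suc k) ({} # Js @ [I]))"
  proof (rule sum.reindex_bij_witness[where i = "\<lambda>Js. (last Js, butlast Js)"
        and j = "\<lambda>(J, Js). Js @ [J]"])
    fix Js assume "Js \<in> S (Suc k) I"
    \<comment> \<open>Here k \<ge> 1 is essential: the length is \<open>Suc k - 1 = k\<close>, so
      there is a last member to split off.\<close>
    moreover from this have "Js \<noteq> []"
      using assms(2) by (auto simp: S_def)
    then obtain Ks J where "Js = Ks @ [J]"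
      using rev_exhaust by blast
    ultimately show "(last Js, butlast Js) \<in> Sigma ?T (S k)"
      and "(case (last Js, butlast Js) of (J, Js) \<Rightarrow> Js @ [J]) = Js"
      by (auto simp: S_def sorted_wrt_subset_snoc2)
  next
    fix p assume p: "p \<in> Sigma ?T (S k)"
    then obtain J Js where [simp]: "p = (J, Js)" and J: "J \<in> order_ideals Q r" "J \<subseteq> I"
      and Js: "Js \<in> S k J"
      by auto
    show "(last (case p of (J, Js) \<Rightarrow> Js @ [J]), butlast (case p of (J, Js) \<Rightarrow> Js @ [J])) = p"
      by simp
    show "(case p of (J, Js) \<Rightarrow> Js @ [J]) \<in> S (Suc k) I"
      using J Js assms(2) by (auto simp: S_def sorted_wrt_subset_snoc2)
    have len: "length ({} # Js @ [J]) = Suc k"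
      using Js assms(2) by (auto simp: S_def)
    \<comment> \<open>The leading \<open>{}\<close> shifts positions by one, so \<open>J\<close> is
      the predecessor of \<open>I\<close> and the new summand counts the maximal elements of
      \<open>I\<close> outside \<open>J\<close>.\<close>
    then have "({} # Js @ [J]) ! k = J"
      by (metis append_Cons diff_Suc_1 last_conv_nth last_snoc list.distinct(1))
    with seq_exponent_snoc[OF len, of r I]
    show "X ^ seq_exponent r (Suc k) ({} # (case p of (J, Js) \<Rightarrow> Js @ [J]) @ [I]) =
        (case p of (J, Js) \<Rightarrow>
          X ^ card (max_elems r I - J) * X ^ seq_exponent r k ({} # Js @ [J]))"
      by (simp add: power_add mult.commute)
  qed
  finally show ?thesis
    by (simp add: ideal_poly_def S_def)
qed

lemma A_mat_carrier: "A_mat Q r e \<in> carrier_mat (num_ideals Q r) (num_ideals Q r)"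
  by (simp add: A_mat_def)

lemma V_vec_carrier: "V_vec Q r e k \<in> carrier_vec (num_ideals Q r)"
  by (simp add: V_vec_def)

lemma A_mat_mult_V_vec:
  assumes "finite Q" and "bij_betw e {0..<num_ideals Q r} (order_ideals Q r)" and "k \<ge> 1"
  shows "A_mat Q r e *\<^sub>v V_vec Q r e k = V_vec Q r e (Suc k)"
proof (rule eq_vecI)
  fix i assume "i < dim_vec (V_vec Q r e (Suc k))"
  then have i: "i < num_ideals Q r"
    by (simp add: V_vec_def)
  let ?f = "\<lambda>J. (if J \<subseteq> e i then X ^ card (max_elems r (e i) - J) else 0) * ideal_poly Q r k J"
  have "(A_mat Q r e *\<^sub>v V_vec Q r e k) $ i = (\<Sum>j = 0..<num_ideals Q r. ?f (e j))"
    using i by (simp add: A_mat_def V_vec_def scalar_prod_def)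
  also have "\<dots> = (\<Sum>J\<in>order_ideals Q r. ?f J)"
    by (rule sum.reindex_bij_betw[OF assms(2)])
  \<comment> \<open>The zero entries of the matrix discard exactly the ideals not contained in
    \<open>e i\<close>.\<close>
  also have "\<dots> = (\<Sum>J | J \<in> order_ideals Q r \<and> J \<subseteq> e i.
      X ^ card (max_elems r (e i) - J) * ideal_poly Q r k J)"
    using finite_order_ideals[OF assms(1)] by (intro sum.mono_neutral_cong_right) auto
  also have "\<dots> = V_vec Q r e (Suc k) $ i"
    using i by (simp add: V_vec_def ideal_poly_Suc[OF assms(1,3)])
  finally show "(A_mat Q r e *\<^sub>v V_vec Q r e k) $ i = V_vec Q r e (Suc k) $ i" .
qed (simp add: A_mat_def V_vec_def)

text \<open>The recursion of \<open>^\<^sub>m\<close> puts the extra factor on the right, where it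
  acts on the vector first and raises \<open>k\<close>. The induction hypothesis is then needed at
  \<open>Suc k\<close>, hence the general starting index.\<close>

lemma A_mat_pow_mult_V_vec:
  assumes "finite Q" and "bij_betw e {0..<num_ideals Q r} (order_ideals Q r)" and "k \<ge> 1"
  shows "(A_mat Q r e ^\<^sub>m n) *\<^sub>v V_vec Q r e k = V_vec Q r e (k + n)"
  using assms(3)
proof (induction n arbitrary: k)
  case 0
  \<comment> \<open>The zeroth power is the identity matrix of size \<open>dim_row\<close>, which
    must match the vector.\<close>
  have "dim_row (A_mat Q r e) = num_ideals Q r"
    by (simp add: A_mat_def)
  then show ?case
    using V_vec_carrier[of Q r e k] by simp
next
  case (Suc n)
  have "(A_mat Q r e ^\<^sub>m Suc n) *\<^sub>v V_vec Q r e k =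
      (A_mat Q r e ^\<^sub>m n) *\<^sub>v (A_mat Q r e *\<^sub>v V_vec Q r e k)"
    using assoc_mult_mat_vec[OF pow_carrier_mat[OF A_mat_carrier] A_mat_carrier V_vec_carrier]
    by simp
  then show ?case
    using Suc.IH[of "Suc k"] A_mat_mult_V_vec[OF assms(1,2) Suc.prems] by simp
qed

theorem theoremA:
  fixes Q :: "'a set" and r :: "('a \<times> 'a) set" and e :: "nat \<Rightarrow> 'a set" and k :: nat
  assumes "finite Q" and "partial_order_on Q r"
    and "connected_poset Q r" and "graded_poset Q r"
    and "bij_betw e {0..<num_ideals Q r} (order_ideals Q r)"
    and "k \<ge> 1"
  shows "V_vec Q r e k = (A_mat Q r e ^\<^sub>m (k - 1)) *\<^sub>v V_vec Q r e 1"
  using A_mat_pow_mult_V_vec[OF assms(1,5), of 1 "k - 1"] assms(6) by simp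

end
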